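(* For every real $s\le 1/2$ the series $$F(s)=\sum_{(a,b,c,d)} f(a,b,c,d)^s,$$ where the sum runs over all quadruples of non-negative integers $a,b,c,d$ with $ad-bc=1$, diverges.
   Context: Here $f(a,b,c,d)=\sqrt{a^2+b^2}+\sqrt{c^2+d^2}-\sqrt{(a+c)^2+(b+d)^2}$. This is positive for every quadruple occurring in the sum. *)

theory Defs
  imports "HOL-Analysis.Infinite_Sum"
begin

definition f :: "real \<Rightarrow> real \<Rightarrow> real \<Rightarrow> real \<Rightarrow> real" where
  "f a b c d = sqrt (a\<^sup>2 + b\<^sup>2) + sqrt (c\<^sup>2 + d\<^sup>2) - sqrt ((a + c)\<^sup>2 + (b + d)\<^sup>2)"

(* The determinant is taken in the integers, so the subtraction is not truncated.
   On this set f is positive, by the strict triangle inequality for the linearly independent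
   vectors (a, b) and (c, d); so the convention 0 powr s = 0 plays no role in powers of f,
   and failure of unordered summability is divergence for every enumeration. *)
definition quadruples :: "(nat \<times> nat \<times> nat \<times> nat) set" where
  "quadruples = {(a, b, c, d). int a * int d - int b * int c = 1}"

end

theory Submission
  imports Defs "HOL-Analysis.Summation_Tests"
begin

text \<open>The divergence already comes from the quadruples \<open>(1, 0, k, 1)\<close>. For vectors \<open>u\<close> and \<open>v\<close>
  spanning a parallelogram of area 1 and enclosing an acute angle, the defect
  \<open>|u| + |v| - |u + v|\<close> has the order of magnitude \<open>1 / (|u| |v| (|u| + |v|))\<close>. With
  \<open>u = (1, 0)\<close> fixed and \<open>v = (k, 1)\<close> this is \<open>1 / k\<^sup>2\<close>, so its square root is comparable to the
  harmonic series (\<open>defect_family_lower\<close>). As these defects are at most 1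
  (\<open>defect_family_le_1\<close>), lowering the exponent below \<open>1 / 2\<close> only enlarges the terms.\<close>

lemma defect_family_le_1:
  fixes x :: real
  assumes "0 \<le> x"
  shows "f 1 0 x 1 \<le> 1"
proof -
  have "sqrt (x\<^sup>2 + 1) \<le> sqrt ((1 + x)\<^sup>2 + 1)"
    using assms by (intro real_sqrt_le_mono) (simp add: power_mono)
  then show ?thesis by (simp add: f_def)
qed

text \<open>Write \<open>A = |v|\<close> and \<open>B = |u + v|\<close>. Rationalizing turns the defect \<open>1 + A - B\<close> into
  \<open>2 (A - x) / (1 + A + B)\<close>, where the numerator is about \<open>1 / x\<close> and the denominator about
  \<open>2 x\<close>. Shifting to \<open>x + 1\<close> makes the bound valid at \<open>x = 0\<close> as well.\<close>
lemma defect_family_lower: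
  fixes x :: real
  assumes x: "0 \<le> x"
  shows "(1 / (2 * (x + 1)))\<^sup>2 \<le> f 1 0 x 1"
proof -
  define A B where "A = sqrt (x\<^sup>2 + 1)" and "B = sqrt ((1 + x)\<^sup>2 + 1)"
  have fAB: "f 1 0 x 1 = 1 + A - B"
    by (simp add: f_def A_def B_def)
  have A2: "A\<^sup>2 = x\<^sup>2 + 1" and B2: "B\<^sup>2 = (1 + x)\<^sup>2 + 1"
    by (simp_all add: A_def B_def)
  have "A \<le> x + 1" "B \<le> x + 2"
    unfolding A_def B_def using x by (auto intro!: real_le_lsqrt simp: power2_eq_square algebra_simps)
  then have "1 + A + B \<le> 2 * x + 4" by linarith
  also have "\<dots> \<le> 4 * (x + 1)" using x by simp
  finally have sum_le: "1 + A + B \<le> 4 * (x + 1)" .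
  have "0 \<le> A" "0 \<le> B" by (simp_all add: A_def B_def)
  then have pos: "0 < 1 + A + B" by linarith
  define t where "t = 1 / (2 * (x + 1))"
  have t: "2 * x * t = 1 - 2 * t" "0 < t" "t \<le> 2"
    using x by (auto simp: t_def field_simps)
  have "x + t \<le> A"
    unfolding A_def
  proof (rule real_le_rsqrt)
    have "t\<^sup>2 \<le> 2 * t" using t by (simp add: power2_eq_square)
    then show "(x + t)\<^sup>2 \<le> x\<^sup>2 + 1"
      unfolding power2_sum using t(1) by linarith
  qed
  then have "2 * t \<le> 2 * (A - x)" by simp
  also have "\<dots> = (1 + A + B) * (1 + A - B)"
    using A2 B2 by (simp add: power2_eq_square algebra_simps)
  finally have prod_ge: "2 * t \<le> (1 + A + B) * (1 + A - B)" .
  then have "0 < (1 + A + B) * (1 + A - B)" using t(2) by linarith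
  then have "0 < 1 + A - B" using pos by (simp add: zero_less_mult_iff)
  then have "(1 + A + B) * (1 + A - B) \<le> 4 * (x + 1) * (1 + A - B)"
    using sum_le by (intro mult_right_mono) auto
  then have "t \<le> 2 * (x + 1) * (1 + A - B)"
    using prod_ge by argo
  then have "t * t \<le> t * (2 * (x + 1) * (1 + A - B))"
    using t(2) by (intro mult_left_mono) auto
  also have "\<dots> = 1 + A - B"
    using x by (simp add: t_def)
  finally show ?thesis
    unfolding fAB t_def [symmetric] by (simp add: power2_eq_square)
qed

text \<open>On the interval between 0 and 1 the power \<open>y powr s\<close> decreases in \<open>s\<close>, so the square root,
  bounded below by the harmonic term, is the worst case.\<close>
lemma defect_family_powr_ge:
  fixes x s :: real
  assumes x: "0 \<le> x" and s: "s \<le> 1 / 2"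
  shows "1 / (2 * (x + 1)) \<le> f 1 0 x 1 powr s"
proof -
  let ?t = "1 / (2 * (x + 1))"
  have t: "0 < ?t" using x by simp
  have "0 < f 1 0 x 1"
    using defect_family_lower [OF x] t by (meson less_le_trans zero_less_power)
  have "?t \<le> sqrt (f 1 0 x 1)"
    using defect_family_lower [OF x] by (rule real_le_rsqrt)
  also have "\<dots> = f 1 0 x 1 powr (1 / 2)"
    using \<open>0 < f 1 0 x 1\<close> by (simp add: powr_half_sqrt)
  also have "\<dots> \<le> f 1 0 x 1 powr s"
    using s \<open>0 < f 1 0 x 1\<close> defect_family_le_1 [OF x] by (intro powr_mono') auto
  finally show ?thesis .
qed

theorem lemma6:
  fixes s :: real
  assumes "s \<le> 1 / 2"
  shows "\<not> (\<lambda>(a, b, c, d). f (real a) (real b) (real c) (real d) powr s) summable_on quadruples"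
    (is "\<not> ?F summable_on _")
proof
  define q :: "nat \<Rightarrow> nat \<times> nat \<times> nat \<times> nat" where "q = (\<lambda>k. (1, 0, k, 1))"
  assume "?F summable_on quadruples"
  moreover have "range q \<subseteq> quadruples"
    by (auto simp: q_def quadruples_def)
  ultimately have "?F summable_on range q"
    by (rule summable_on_subset_banach)
  moreover have "inj q" by (auto simp: q_def inj_def)
  ultimately have "(?F \<circ> q) summable_on UNIV"
    by (simp add: summable_on_reindex)
  then have "summable (\<lambda>k. f 1 0 (real k) 1 powr s)"
    by (auto simp: q_def o_def dest: summable_on_imp_summable)
  then have "summable (\<lambda>k. 1 / (2 * (real k + 1)))"
    by (rule summable_comparison_test') (use defect_family_powr_ge assms in auto)
  then have "summable (\<lambda>k. 2 * (1 / (2 * (real k + 1))))"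
    by (rule summable_mult)
  moreover have "2 * (1 / (2 * (real k + 1))) = inverse (real (Suc k))" for k
    by (simp add: field_simps)
  ultimately have "summable (\<lambda>k. inverse (real (Suc k)))"
    by simp
  then have "summable (\<lambda>k. inverse (real k))"
    by (subst (asm) summable_Suc_iff)
  then show False
    using not_summable_harmonic [where 'a = real] by simp
qed

end
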